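(* Let $p=1$ or $p=\infty$, and let $\alpha\in\mathbb N$. For any $q>0$ there exists a function $f\in L_p(\mathbb T)$ such that there is no constant $C$, independent of $n$, for which $$\Big(\sum_{k=n+1}^\infty2^{-q\alpha k}\|(\eta_{2^k}f)^{(\alpha)}\|_{L_p(\mathbb T)}^q\Big)^{1/q}\le C\,\omega_\alpha(f,2^{-n})_{L_p(\mathbb T)}$$ holds for all $n\in\mathbb N$.
   Context: $\mathbb T=[0,2\pi]$. The de la Vallée Poussin means are $\eta_Nf(x)=\sum_{k\in\mathbb Z}\eta(|k|/N)\widehat f(k)e^{ikx}$, where $\eta\in C^\infty[0,\infty)$, $\eta(\xi)=1$ for $\xi\le1/2$, $\eta(\xi)=0$ for $\xi\ge1$, and $\widehat f(k)=\frac1{2\pi}\int_{\mathbb T}f(y)e^{-iky}dy$. For $\alpha\in\mathbb N$, $\omega_\alpha(f,\delta)_{L_p(\mathbb T)}=\sup_{|h|\le\delta}\|\Delta_h^\alpha f\|_{L_p(\mathbb T)}$ with $\Delta_hf(x)=f(x+h)-f(x)$, $\Delta_h^\alpha=\Delta_h\Delta_h^{\alpha-1}$. *)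

theory Defs
  imports "HOL-Analysis.Analysis" "HOL-Probability.Essential_Supremum"
begin

text \<open>Extended nonnegative powers, used only with exponents \<open>r > 0\<close> (so that
  \<open>\<infinity>\<close> to the power \<open>r\<close> is \<open>\<infinity>\<close> and \<open>0\<close> to the power \<open>r\<close> is \<open>0\<close>). Norms and series below
  take values in \<^typ>\<open>ennreal\<close>, so that a divergent series has the value \<open>\<infinity>\<close>.\<close>

definition epowr :: "ennreal \<Rightarrow> real \<Rightarrow> ennreal"  (infixr \<open>epowr\<close> 80) where
  "x epowr r = (if x = \<infinity> then \<infinity> else ennreal (enn2real x powr r))"

text \<open>The torus is the period interval \<open>[0, 2\<pi>]\<close> with (unnormalised) Lebesgue measure.
  Functions on it are represented by \<open>2\<pi>\<close>-periodic functions on the real line, so that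
  translates make sense.\<close>

abbreviation torus :: "real measure" where
  "torus \<equiv> lebesgue_on {0..2 * pi}"

definition Lp_norm :: "ennreal \<Rightarrow> (real \<Rightarrow> complex) \<Rightarrow> ennreal" where
  "Lp_norm p f =
     (if p = \<infinity> then esssup torus (\<lambda>x. ennreal (norm (f x)))
      else (\<integral>\<^sup>+ x. ennreal (norm (f x) powr enn2real p) \<partial>torus) epowr (1 / enn2real p))"

definition Lp_torus :: "ennreal \<Rightarrow> (real \<Rightarrow> complex) set" where
  "Lp_torus p =
     {f. f \<in> borel_measurable lebesgue \<and> (\<forall>x. f (x + 2 * pi) = f x) \<and> Lp_norm p f < \<infinity>}"

definition fourier_coeff :: "(real \<Rightarrow> complex) \<Rightarrow> int \<Rightarrow> complex" where
  "fourier_coeff f k =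
     1 / (2 * pi) * (LINT y|torus. f y * exp (- \<i> * of_int k * of_real y))"

text \<open>\<open>C\<^sup>\<infinity>\<close> on the closed half-line (one-sided derivatives at \<open>0\<close>); \<open>D n\<close> is the
  \<open>n\<close>-th derivative.\<close>

definition smooth_on_halfline :: "(real \<Rightarrow> real) \<Rightarrow> bool" where
  "smooth_on_halfline g \<longleftrightarrow>
     (\<exists>D :: nat \<Rightarrow> real \<Rightarrow> real.
        (\<forall>x\<ge>0. D 0 x = g x) \<and>
        (\<forall>n. \<forall>x\<ge>0. (D n has_real_derivative D (Suc n) x) (at x within {0..})))"

definition vp_cutoff :: "(real \<Rightarrow> real) \<Rightarrow> bool" where
  "vp_cutoff \<eta> \<longleftrightarrow>
     smooth_on_halfline \<eta> \<and> (\<forall>\<xi>. 0 \<le> \<xi> \<and> \<xi> \<le> 1/2 \<longrightarrow> \<eta> \<xi> = 1) \<and> (\<forall>\<xi>\<ge>1. \<eta> \<xi> = 0)"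

text \<open>For a cutoff \<open>\<eta>\<close> and \<open>N \<ge> 1\<close> only finitely many terms of the sum are nonzero.\<close>

definition vp_mean :: "(real \<Rightarrow> real) \<Rightarrow> nat \<Rightarrow> (real \<Rightarrow> complex) \<Rightarrow> real \<Rightarrow> complex" where
  "vp_mean \<eta> N f x =
     (\<Sum>\<^sub>\<infinity>k::int. of_real (\<eta> (real_of_int \<bar>k\<bar> / real N)) * fourier_coeff f k
                * exp (\<i> * of_int k * of_real x))"

definition nth_deriv :: "nat \<Rightarrow> (real \<Rightarrow> complex) \<Rightarrow> real \<Rightarrow> complex" where
  "nth_deriv m = (\<lambda>g x. vector_derivative g (at x)) ^^ m"

definition fdiff :: "real \<Rightarrow> (real \<Rightarrow> complex) \<Rightarrow> real \<Rightarrow> complex" where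
  "fdiff h f x = f (x + h) - f x"

definition modulus :: "nat \<Rightarrow> ennreal \<Rightarrow> (real \<Rightarrow> complex) \<Rightarrow> real \<Rightarrow> ennreal" where
  "modulus \<alpha> p f \<delta> = (SUP h\<in>{h. \<bar>h\<bar> \<le> \<delta>}. Lp_norm p ((fdiff h ^^ \<alpha>) f))"

end

theory Submission
  imports Defs
begin

text \<open>The terms \<open>2\<^bsup>-\<alpha>k\<^esup> \<parallel>(\<eta>\<^bsub>2^k\<^esub> f)\<^bsup>(\<alpha>)\<^esup>\<parallel>\<close> need not be \<open>q\<close>-summable, while \<open>\<omega>\<^sub>\<alpha>(f, \<delta>)\<close> is
  always finite.
  For \<open>p = \<infinity>\<close> take the sawtooth, with Fourier coefficients \<open>\<i> / k\<close>: since it jumps, the terms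
  stay bounded away from \<open>0\<close>, as one sees by testing against modulated Fejer kernels.
  For \<open>p = 1\<close> take \<open>f = \<Sum>\<^sub>j 2\<^bsup>-j\<^esup> F\<^bsub>N j\<^esub>\<close> with Fejer kernels \<open>F\<close>. The \<open>k\<close>-th term is at least
  a constant times the Fourier coefficient of \<open>f\<close> at \<open>2\<^bsup>k-1\<^esup>\<close>, which is at least \<open>2\<^bsup>-j-1\<^esup>\<close> whenever
  \<open>2\<^bsup>k\<^esup> \<le> N j\<close>; if \<open>N j\<close> grows fast enough, the \<open>q\<close>-th powers have a divergent sum.\<close>


subsection \<open>Trigonometric polynomials and de la Vallee Poussin means\<close>

definition char :: "int \<Rightarrow> real \<Rightarrow> complex" where
  "char k x = exp (\<i> * of_int k * of_real x)"

lemma norm_char [simp]: "norm (char k x) = 1"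
  by (simp add: char_def norm_exp_eq_Re)

lemma char_add: "char (k + l) x = char k x * char l x"
  by (simp add: char_def exp_add [symmetric] algebra_simps)

lemma char_0 [simp]: "char 0 x = 1"
  by (simp add: char_def)

lemma char_shift: "char k (x + y) = char k x * char k y"
  by (simp add: char_def exp_add [symmetric] algebra_simps)

lemma char_period [simp]: "char k (2 * pi) = 1"
  unfolding char_def
  by (subst exp_eq_1) (auto simp: mult_ac)

lemma cnj_char: "cnj (char k x) = char (- k) x"
  by (simp add: char_def exp_cnj)

lemma continuous_on_char [continuous_intros]: "continuous_on S (char k)"
  unfolding char_def by (intro continuous_intros)

lemma has_vector_derivative_char:
  "(char k has_vector_derivative \<i> * of_int k * char k x) (at x within S)"
proof -
  have "((\<lambda>z. exp (\<i> * of_int k * z)) has_field_derivative \<i> * of_int k * exp (\<i> * of_int k * of_real x))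
      (at (of_real x))"
    by (auto intro!: derivative_eq_intros)
  from has_vector_derivative_real_field [OF this] show ?thesis
    unfolding char_def by (rule has_vector_derivative_at_within)
qed

lemma integrable_torus_continuous:
  fixes g :: "real \<Rightarrow> complex"
  shows "continuous_on UNIV g \<Longrightarrow> integrable torus g"
  by (meson continuous_imp_integrable_real continuous_on_subset subset_UNIV)

lemma torus_integral_FTC:
  fixes F g :: "real \<Rightarrow> complex"
  assumes "\<And>x. (F has_vector_derivative g x) (at x)" "continuous_on UNIV g"
  shows "(LINT x|torus. g x) = F (2 * pi) - F 0"
proof -
  have "(g has_integral F (2 * pi) - F 0) {0..2 * pi}"
    by (rule fundamental_theorem_of_calculus) (auto intro: has_vector_derivative_at_within assms)
  moreover have "integrable torus g"
    using assms(2) by (rule integrable_torus_continuous)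
  ultimately show ?thesis
    by (simp add: lebesgue_integral_eq_integral integral_unique)
qed

lemma integral_char: "(LINT x|torus. char k x) = (if k = 0 then 2 * pi else 0)"
proof (cases "k = 0")
  case True
  then show ?thesis
    by (subst torus_integral_FTC [where F = of_real])
      (auto intro!: continuous_intros derivative_eq_intros)
next
  case False
  have "(LINT x|torus. char k x) = char k (2 * pi) / (\<i> * of_int k) - char k 0 / (\<i> * of_int k)"
  proof (rule torus_integral_FTC)
    show "((\<lambda>x. char k x / (\<i> * of_int k)) has_vector_derivative char k x) (at x)" for x
      using has_vector_derivative_divide [OF has_vector_derivative_char, of k "\<i> * of_int k" x UNIV] False
      by simp
  qed (intro continuous_intros)
  then show ?thesis
    using False by (simp only: char_period) (simp add: char_def)
qed

text \<open>Orthogonality of the characters: after multiplication by \<open>char (- m)\<close> only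
  frequency \<open>m\<close> survives integration, so this reads off a single coefficient.\<close>

lemma integral_trig_poly:
  fixes c :: "int \<Rightarrow> complex"
  assumes "finite K"
  shows "(LINT x|torus. (\<Sum>k\<in>K. c k * char k x) * char (- m) x) = (if m \<in> K then 2 * pi * c m else 0)"
proof -
  have "(LINT x|torus. (\<Sum>k\<in>K. c k * char k x) * char (- m) x)
      = (LINT x|torus. (\<Sum>k\<in>K. c k * char (k - m) x))"
    by (simp add: sum_distrib_right char_add [symmetric] mult.assoc)
  also have "\<dots> = (\<Sum>k\<in>K. c k * (LINT x|torus. char (k - m) x))"
    by (subst Bochner_Integration.integral_sum)
      (auto intro!: integrable_torus_continuous continuous_intros)
  also have "\<dots> = (\<Sum>k\<in>K. if k = m then 2 * pi * c m else 0)"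
    by (intro sum.cong) (auto simp: integral_char)
  finally show ?thesis
    using assms by simp
qed

lemma nth_deriv_trig_poly:
  fixes c :: "int \<Rightarrow> complex"
  shows "nth_deriv m (\<lambda>x. \<Sum>k\<in>K. c k * char k x) = (\<lambda>x. \<Sum>k\<in>K. c k * (\<i> * of_int k) ^ m * char k x)"
proof (induction m)
  case (Suc m)
  have "((\<lambda>x. \<Sum>k\<in>K. c k * (\<i> * of_int k) ^ m * char k x) has_vector_derivative
      (\<Sum>k\<in>K. c k * (\<i> * of_int k) ^ Suc m * char k x)) (at x)" for x
  proof -
    have "((\<lambda>x. \<Sum>k\<in>K. c k * (\<i> * of_int k) ^ m * char k x) has_vector_derivative
        (\<Sum>k\<in>K. c k * (\<i> * of_int k) ^ m * (\<i> * of_int k * char k x))) (at x)"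
      by (intro has_vector_derivative_sum has_vector_derivative_mult_right has_vector_derivative_char)
    then show ?thesis
      by (simp add: mult_ac)
  qed
  then have "vector_derivative (\<lambda>x. \<Sum>k\<in>K. c k * (\<i> * of_int k) ^ m * char k x) (at x)
      = (\<Sum>k\<in>K. c k * (\<i> * of_int k) ^ Suc m * char k x)" for x
    by (rule vector_derivative_at)
  then show ?case
    using Suc by (simp add: nth_deriv_def)
qed (simp add: nth_deriv_def)

text \<open>The cutoff vanishes from 1 on, so the infinite sum collapses to a finite one that can be
  differentiated and integrated term by term.\<close>

lemma vp_mean_trig_poly:
  assumes "vp_cutoff \<eta>" "N \<ge> 1"
  shows "vp_mean \<eta> N f = (\<lambda>x. \<Sum>k\<in>{- int N..int N}. of_real (\<eta> (real_of_int \<bar>k\<bar> / real N)) * fourier_coeff f k * char k x)"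
proof
  fix x
  have "\<eta> (real_of_int \<bar>k\<bar> / real N) = 0" if "k \<notin> {- int N..int N}" for k
    using assms that by (auto simp: vp_cutoff_def field_simps)
  then have "vp_mean \<eta> N f x = infsum (\<lambda>k. of_real (\<eta> (real_of_int \<bar>k\<bar> / real N)) * fourier_coeff f k * char k x) {- int N..int N}"
    unfolding vp_mean_def char_def by (intro infsum_cong_neutral) auto
  then show "vp_mean \<eta> N f x = (\<Sum>k\<in>{- int N..int N}. of_real (\<eta> (real_of_int \<bar>k\<bar> / real N)) * fourier_coeff f k * char k x)"
    by simp
qed

text \<open>The cutoff equals 1 at frequencies up to \<open>N / 2\<close>. There the mean keeps the
  Fourier coefficients of \<open>f\<close>, and each derivative contributes a factor
  \<open>\<i> * m\<close>.\<close>

lemma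
  assumes "vp_cutoff \<eta>" "N \<ge> 1"
  shows continuous_on_nth_deriv_vp_mean: "continuous_on S (nth_deriv \<alpha> (vp_mean \<eta> N f))"
    and integral_nth_deriv_vp_mean: "2 * \<bar>m\<bar> \<le> int N \<Longrightarrow>
      (LINT x|torus. nth_deriv \<alpha> (vp_mean \<eta> N f) x * char (- m) x)
        = 2 * pi * (\<i> * of_int m) ^ \<alpha> * fourier_coeff f m"
proof -
  note eq = vp_mean_trig_poly [OF assms] nth_deriv_trig_poly
  show "continuous_on S (nth_deriv \<alpha> (vp_mean \<eta> N f))"
    unfolding eq by (intro continuous_intros)
  assume m: "2 * \<bar>m\<bar> \<le> int N"
  then have "\<eta> (real_of_int \<bar>m\<bar> / real N) = 1"
    using assms by (auto simp: vp_cutoff_def field_simps)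
  moreover have "m \<in> {- int N..int N}"
    using m by auto
  ultimately show "(LINT x|torus. nth_deriv \<alpha> (vp_mean \<eta> N f) x * char (- m) x)
        = 2 * pi * (\<i> * of_int m) ^ \<alpha> * fourier_coeff f m"
    unfolding eq by (subst integral_trig_poly) auto
qed

subsection \<open>Fejer kernels\<close>

text \<open>The squared modulus makes nonnegativity immediate; expanding it gives the usual
  triangular Fourier weights. For \<open>N = 0\<close> division by zero yields the zero
  function.\<close>

definition fejer :: "nat \<Rightarrow> real \<Rightarrow> real" where
  "fejer N x = (norm (\<Sum>j<N. char (int j) x))\<^sup>2 / N"

lemma fejer_nonneg: "fejer N x \<ge> 0"
  by (simp add: fejer_def)

lemma fejer_periodic: "fejer N (x + 2 * pi) = fejer N x"
  by (simp add: fejer_def char_shift)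

lemma fejer_eq: "complex_of_real (fejer N x) = (\<Sum>r<N. \<Sum>s<N. char (int r - int s) x) / N"
proof -
  have "complex_of_real ((norm (\<Sum>j<N. char (int j) x))\<^sup>2) = (\<Sum>r<N. \<Sum>s<N. char (int r - int s) x)"
    by (subst complex_norm_square) (simp add: sum_product cnj_char char_add [symmetric])
  then show ?thesis
    unfolding fejer_def by simp
qed

lemma continuous_on_fejer [continuous_intros]: "continuous_on S (fejer N)"
proof (cases "N = 0")
  case False
  then show ?thesis
    unfolding fejer_def by (intro continuous_intros) auto
qed (simp add: fejer_def)

text \<open>Only the \<open>N\<close> diagonal terms \<open>r = s\<close> contribute. The shift
  multiplies the term at \<open>(r, s)\<close> by a character value, which is 1 on the diagonal; so
  no translation invariance on the torus has to be invoked.\<close>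

lemma integral_fejer_shift:
  assumes "N \<ge> 1"
  shows "(LINT x|torus. fejer N (x + h)) = 2 * pi"
proof -
  have "complex_of_real (LINT x|torus. fejer N (x + h)) = (LINT x|torus. complex_of_real (fejer N (x + h)))"
    by simp
  also have "\<dots> = (LINT x|torus. (\<Sum>r<N. \<Sum>s<N. char (int r - int s) h * char (int r - int s) x) / N)"
    by (simp only: fejer_eq char_shift mult.commute)
  also have "\<dots> = (\<Sum>r<N. \<Sum>s<N. char (int r - int s) h * (LINT x|torus. char (int r - int s) x)) / N"
    by (simp add: Bochner_Integration.integral_sum integrable_torus_continuous continuous_intros)
  also have "\<dots> = (\<Sum>r<N. \<Sum>s<N. complex_of_real (if r = s then 2 * pi else 0)) / N"
  proof -
    have "char (int r - int s) h * (LINT x|torus. char (int r - int s) x)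
        = complex_of_real (if r = s then 2 * pi else 0)" for r s
      by (simp add: integral_char)
    then show ?thesis
      by simp
  qed
  also have "\<dots> = complex_of_real (2 * pi)"
    using assms by (simp add: if_distrib cong: if_cong)
  finally show ?thesis
    by (simp only: of_real_eq_iff)
qed

lemma nn_integral_fejer_shift:
  assumes "N \<ge> 1"
  shows "(\<integral>\<^sup>+ x. ennreal (fejer N (x + h)) \<partial>torus) = ennreal (2 * pi)"
proof -
  have "integrable torus (\<lambda>x. fejer N (x + h))"
    by (rule continuous_imp_integrable_real)
      (intro continuous_on_compose2 [OF continuous_on_fejer [of UNIV]] continuous_intros subset_UNIV)
  then show ?thesis
    using integral_fejer_shift [OF assms, of h] by (subst nn_integral_eq_integral) (auto simp: fejer_nonneg)
qed

lemma integral_mult_fejer: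
  fixes g :: "real \<Rightarrow> complex"
  assumes "continuous_on UNIV g"
  shows "(LINT x|torus. g x * fejer N x) = (\<Sum>r<N. \<Sum>s<N. (LINT x|torus. g x * char (int r - int s) x)) / N"
proof -
  have "(LINT x|torus. g x * fejer N x) = (LINT x|torus. (\<Sum>r<N. \<Sum>s<N. g x * char (int r - int s) x) / N)"
    by (simp add: fejer_eq sum_distrib_left)
  also have "\<dots> = (\<Sum>r<N. \<Sum>s<N. (LINT x|torus. g x * char (int r - int s) x)) / N"
    by (simp add: Bochner_Integration.integral_sum integrable_torus_continuous continuous_intros assms)
  finally show ?thesis .
qed

subsection \<open>Norms and moduli\<close>

lemma borel_measurable_torus:
  "g \<in> borel_measurable borel \<Longrightarrow> g \<in> borel_measurable torus"
  by (intro measurable_restrict_space1 measurable_completion) simp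

lemma Lp_norm_1: "Lp_norm 1 f = (\<integral>\<^sup>+ x. ennreal (norm (f x)) \<partial>torus)"
  by (cases "\<integral>\<^sup>+ x. ennreal (norm (f x)) \<partial>torus") (auto simp: Lp_norm_def epowr_def)

lemma norm_integral_le_Lp_norm_1:
  fixes g :: "real \<Rightarrow> complex"
  assumes "continuous_on UNIV g"
  shows "ennreal (norm (LINT x|torus. g x * char k x)) \<le> Lp_norm 1 g"
proof -
  have "integrable torus (\<lambda>x. g x * char k x)"
    using assms by (intro integrable_torus_continuous continuous_intros)
  from integral_norm_bound_ennreal [OF this] show ?thesis
    by (simp add: Lp_norm_1 norm_mult)
qed

text \<open>Hoelder's inequality between the sup norm and the integral norm: the modulated kernel
  has modulus \<open>fejer N\<close>, of total mass \<open>2 * pi\<close>.\<close>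

lemma norm_integral_fejer_le_Lp_norm_infinity:
  fixes g :: "real \<Rightarrow> complex"
  assumes "continuous_on UNIV g" "N \<ge> 1"
  shows "ennreal (norm (LINT x|torus. g x * char k x * fejer N x)) \<le> Lp_norm \<infinity> g * ennreal (2 * pi)"
proof -
  have "integrable torus (\<lambda>x. g x * char k x * fejer N x)"
    using assms by (intro integrable_torus_continuous continuous_intros)
  from integral_norm_bound_ennreal [OF this]
  have "ennreal (norm (LINT x|torus. g x * char k x * fejer N x))
      \<le> (\<integral>\<^sup>+ x. ennreal (norm (g x)) * ennreal (fejer N x) \<partial>torus)"
    by (simp add: norm_mult fejer_nonneg ennreal_mult)
  also have "\<dots> \<le> (\<integral>\<^sup>+ x. Lp_norm \<infinity> g * ennreal (fejer N x) \<partial>torus)"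
  proof (rule nn_integral_mono_AE)
    show "AE x in torus. ennreal (norm (g x)) * ennreal (fejer N x) \<le> Lp_norm \<infinity> g * ennreal (fejer N x)"
      using esssup_AE [of "\<lambda>x. ennreal (norm (g x))" torus]
      by eventually_elim (auto simp: Lp_norm_def intro: mult_right_mono)
  qed
  also have "\<dots> = Lp_norm \<infinity> g * ennreal (2 * pi)"
    using nn_integral_fejer_shift [OF assms(2), of 0]
    by (subst nn_integral_cmult)
      (auto intro!: borel_measurable_torus borel_measurable_continuous_onI continuous_intros measurable_compose [OF _ measurable_ennreal])
  finally show ?thesis .
qed

section \<open>Divergence of the series of \<open>q\<close>-th powers\<close>

lemma ennreal_powr_le_epowr:
  assumes "ennreal a \<le> X" "a \<ge> 0" "q > 0"
  shows "ennreal (a powr q) \<le> X epowr q"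
proof (cases "X = \<infinity>")
  case False
  then have "X = ennreal (enn2real X)"
    by (simp add: less_top)
  then have "a \<le> enn2real X"
    using assms by (metis ennreal_le_iff enn2real_nonneg)
  then show ?thesis
    using False assms by (auto simp: epowr_def intro!: ennreal_leI powr_mono2)
qed (simp add: epowr_def)

text \<open>Every finite partial sum is a lower bound for the full sum of nonnegative terms, so
  unbounded partial sums rule out a finite value.\<close>

lemma infsum_ennreal_eq_top:
  fixes A :: "'a \<Rightarrow> ennreal"
  assumes "\<And>B::real. \<exists>F\<subseteq>I. finite F \<and> ennreal B \<le> sum A F"
  shows "infsum A I = \<infinity>"
proof -
  have "ennreal B \<le> infsum A I" for B
  proof -
    obtain F where F: "F \<subseteq> I" "finite F" "ennreal B \<le> sum A F"
      using assms by blast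
    moreover have "sum A F \<le> infsum A I"
      using infsum_mono_neutral [of A F A I] F by (auto simp: nonneg_summable_on_complete)
    ultimately show ?thesis
      by order
  qed
  then have "infsum A I \<noteq> ennreal r" if "r \<ge> 0" for r
    using that by (metis ennreal_le_iff less_add_one not_less)
  then show ?thesis
    by (cases "infsum A I") auto
qed

text \<open>Already for \<open>n = 2\<close> the left-hand side is infinite while the modulus is finite.\<close>

lemma no_constant_if_divergent:
  assumes "0 < c" "q > 0" "\<And>k. 0 \<le> b k"
    and lower: "\<And>k. k \<ge> 3 \<Longrightarrow> ennreal (c * 2 ^ (\<alpha> * k) * b k) \<le> Lp_norm p (nth_deriv \<alpha> (vp_mean \<eta> (2 ^ k) f))"
    and div: "\<And>B::real. \<exists>F\<subseteq>{3..}. finite F \<and> B \<le> (\<Sum>k\<in>F. b k powr q)"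
    and "\<And>\<delta>. modulus \<alpha> p f \<delta> < \<infinity>"
  shows "\<not> (\<exists>C::real. C \<ge> 0 \<and>
                (\<forall>n::nat. n \<ge> 1 \<longrightarrow>
                   (\<Sum>\<^sub>\<infinity>k\<in>{n+1..}. ennreal (2 powr (- q * real \<alpha> * real k))
                        * Lp_norm p (nth_deriv \<alpha> (vp_mean \<eta> (2 ^ k) f)) epowr q) epowr (1 / q)
                   \<le> ennreal C * modulus \<alpha> p f (2 powr (- real n))))"
proof -
  define A where "A k = ennreal (2 powr (- q * real \<alpha> * real k))
    * Lp_norm p (nth_deriv \<alpha> (vp_mean \<eta> (2 ^ k) f)) epowr q" for k
  have A: "ennreal (c powr q * b k powr q) \<le> A k" if "k \<ge> 3" for k
  proof -
    \<comment> \<open>The weight of the series exactly cancels the \<open>q\<close>-th power of the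
      growth \<open>2 ^ (\<alpha> * k)\<close>, so only \<open>c\<close> and \<open>b k\<close>
      remain.\<close>
    have "(2 powr (- q * real \<alpha> * real k)) * ((2 ^ (\<alpha> * k)) powr q) = (1::real)"
      by (simp add: powr_realpow [symmetric] powr_powr powr_add [symmetric] mult_ac)
    then have "c powr q * b k powr q = 2 powr (- q * real \<alpha> * real k) * (c * 2 ^ (\<alpha> * k) * b k) powr q"
      using assms(1,3) by (simp add: powr_mult mult_ac)
    then have "ennreal (c powr q * b k powr q)
      = ennreal (2 powr (- q * real \<alpha> * real k)) * ennreal ((c * 2 ^ (\<alpha> * k) * b k) powr q)"
      by (simp add: ennreal_mult)
    also have "\<dots> \<le> A k"
      unfolding A_def
      by (intro mult_left_mono ennreal_powr_le_epowr lower that assms) (use assms in auto)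
    finally show ?thesis .
  qed
  \<comment> \<open>The index set \<open>{n + 1..}\<close> at \<open>n = 2\<close> starts at 3,
    where the lower bound on the norms becomes available.\<close>
  have "infsum A {2 + 1..} = \<infinity>"
  proof (rule infsum_ennreal_eq_top)
    fix B :: real
    obtain F where F: "F \<subseteq> {3..}" "finite F" "B / c powr q \<le> (\<Sum>k\<in>F. b k powr q)"
      using div by blast
    then have "ennreal B \<le> ennreal (\<Sum>k\<in>F. c powr q * b k powr q)"
      using assms(1) by (intro ennreal_leI) (simp add: field_simps sum_distrib_left)
    also have "\<dots> = (\<Sum>k\<in>F. ennreal (c powr q * b k powr q))"
      by (simp add: sum_ennreal)
    also have "\<dots> \<le> sum A F"
      using F A by (intro sum_mono) auto
    finally show "\<exists>F\<subseteq>{2 + 1..}. finite F \<and> ennreal B \<le> sum A F"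
      using F by auto
  qed
  then have "infsum A {2 + 1..} epowr (1 / q) = \<infinity>"
    by (simp add: epowr_def)
  moreover have "ennreal C * modulus \<alpha> p f (2 powr (- real 2)) \<noteq> \<infinity>" for C
    using assms(6) by (metis ennreal_less_top ennreal_mult_less_top infinity_ennreal_def order_less_irrefl)
  ultimately show ?thesis
    unfolding A_def [symmetric]
    by (metis infinity_ennreal_def top.extremum_unique one_le_numeral)
qed

lemma fourier_coeff_char: "fourier_coeff f k = 1 / (2 * pi) * (LINT y|torus. f y * char (- k) y)"
  by (simp add: fourier_coeff_def char_def)

section \<open>Finiteness of the moduli of smoothness\<close>

lemma norm_fdiff_funpow_le:
  assumes "\<And>x. norm (f x) \<le> M"
  shows "norm ((fdiff h ^^ \<alpha>) f x) \<le> 2 ^ \<alpha> * M"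
proof (induction \<alpha> arbitrary: x)
  case (Suc \<alpha>)
  have "norm ((fdiff h ^^ Suc \<alpha>) f x) \<le> norm ((fdiff h ^^ \<alpha>) f (x + h)) + norm ((fdiff h ^^ \<alpha>) f x)"
    by (simp add: fdiff_def norm_triangle_ineq4)
  also have "\<dots> \<le> 2 ^ \<alpha> * M + 2 ^ \<alpha> * M"
    by (intro add_mono Suc)
  finally show ?case
    by (simp add: mult_ac)
qed (simp add: assms)

lemma borel_measurable_fdiff_funpow [measurable]:
  assumes [measurable]: "f \<in> borel_measurable borel"
  shows "(fdiff h ^^ \<alpha>) f \<in> borel_measurable borel"
proof (induction \<alpha>)
  case (Suc \<alpha>)
  note [measurable] = Suc
  have "(\<lambda>x. (fdiff h ^^ \<alpha>) f (x + h) - (fdiff h ^^ \<alpha>) f x) \<in> borel_measurable borel"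
    by measurable
  then show ?case
    by (simp add: fdiff_def [abs_def])
qed simp

lemma Lp_norm_infinity_le:
  assumes "f \<in> borel_measurable borel" "\<And>x. norm (f x) \<le> M"
  shows "Lp_norm \<infinity> f \<le> ennreal M"
  unfolding Lp_norm_def using assms
  by (auto intro!: esssup_I borel_measurable_torus ennreal_leI)

lemma modulus_infinity_finite:
  assumes "f \<in> borel_measurable borel" "\<And>x. norm (f x) \<le> M"
  shows "modulus \<alpha> \<infinity> f \<delta> < \<infinity>"
proof -
  have "modulus \<alpha> \<infinity> f \<delta> \<le> ennreal (2 ^ \<alpha> * M)"
    unfolding modulus_def
    by (intro SUP_least Lp_norm_infinity_le borel_measurable_fdiff_funpow norm_fdiff_funpow_le assms)
  then show ?thesis
    by (simp add: order_le_less_trans)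
qed

text \<open>Each difference at most doubles the bound. Since a difference involves a translate, the
  induction runs over all shifts \<open>t\<close> at once, and the uniform hypothesis takes the
  place of translation invariance.\<close>

lemma nn_integral_fdiff_funpow_le:
  assumes [measurable]: "f \<in> borel_measurable borel"
    and "\<And>t. (\<integral>\<^sup>+ x. ennreal (norm (f (x + t))) \<partial>torus) \<le> K"
  shows "(\<integral>\<^sup>+ x. ennreal (norm ((fdiff h ^^ \<alpha>) f (x + t))) \<partial>torus) \<le> 2 ^ \<alpha> * K"
proof (induction \<alpha> arbitrary: t)
  case (Suc \<alpha>)
  let ?g = "(fdiff h ^^ \<alpha>) f"
  have meas: "(\<lambda>x. ennreal (norm (?g (x + s)))) \<in> borel_measurable torus" for s
    by (rule borel_measurable_torus) measurable
  have "(\<integral>\<^sup>+ x. ennreal (norm ((fdiff h ^^ Suc \<alpha>) f (x + t))) \<partial>torus)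
      \<le> (\<integral>\<^sup>+ x. ennreal (norm (?g (x + (t + h)))) + ennreal (norm (?g (x + t))) \<partial>torus)"
    by (intro nn_integral_mono)
      (simp add: fdiff_def norm_triangle_ineq4 add.assoc flip: ennreal_plus)
  also have "\<dots> = (\<integral>\<^sup>+ x. ennreal (norm (?g (x + (t + h)))) \<partial>torus)
      + (\<integral>\<^sup>+ x. ennreal (norm (?g (x + t))) \<partial>torus)"
    by (intro nn_integral_add meas)
  also have "\<dots> \<le> 2 ^ \<alpha> * K + 2 ^ \<alpha> * K"
    by (intro add_mono Suc)
  also have "\<dots> = 2 ^ Suc \<alpha> * K"
    by (simp only: power_Suc mult_2 distrib_right)
  finally show ?case .
qed (simp add: assms)

lemma modulus_1_finite:
  assumes "f \<in> borel_measurable borel"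
    and "\<And>t. (\<integral>\<^sup>+ x. ennreal (norm (f (x + t))) \<partial>torus) \<le> ennreal K"
  shows "modulus \<alpha> 1 f \<delta> < \<infinity>"
proof -
  have "modulus \<alpha> 1 f \<delta> \<le> 2 ^ \<alpha> * ennreal K"
    unfolding modulus_def Lp_norm_1
    using nn_integral_fdiff_funpow_le [OF assms, of _ _ 0] by (intro SUP_least) simp
  also have "\<dots> < \<infinity>"
    by (simp add: ennreal_mult_less_top power_less_top_ennreal)
  finally show ?thesis .
qed

subsection \<open>The case of the sup norm: the sawtooth\<close>

text \<open>The periodic extension of the identity on \<open>[0, 2 * pi)\<close>, with a jump at the
  multiples of \<open>2 * pi\<close>.\<close>

definition sawtooth :: "real \<Rightarrow> complex" where
  "sawtooth x = of_real (2 * pi * frac (x / (2 * pi)))"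

lemma borel_measurable_sawtooth: "sawtooth \<in> borel_measurable borel"
  unfolding sawtooth_def frac_def by measurable

lemma norm_sawtooth_le: "norm (sawtooth x) \<le> 2 * pi"
  using frac_ge_0 [of "x / (2 * pi)"] frac_lt_1 [of "x / (2 * pi)"]
  unfolding sawtooth_def norm_of_real by (simp add: abs_mult mult_left_le)

lemma sawtooth_in_Lp: "sawtooth \<in> Lp_torus \<infinity>"
proof -
  have "sawtooth (x + 2 * pi) = sawtooth x" for x
    by (simp add: sawtooth_def add_divide_distrib frac_def)
  moreover have "Lp_norm \<infinity> sawtooth < \<infinity>"
    using Lp_norm_infinity_le [OF borel_measurable_sawtooth norm_sawtooth_le]
    by (simp add: order_le_less_trans)
  ultimately show ?thesis
    using borel_measurable_sawtooth by (simp add: Lp_torus_def measurable_completion)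
qed

lemma fourier_coeff_sawtooth:
  assumes "k \<noteq> 0"
  shows "fourier_coeff sawtooth k = \<i> / of_int k"
proof -
  \<comment> \<open>At the right endpoint the sawtooth has already dropped to 0; elsewhere on the
    period it is the identity.\<close>
  have "AE y in torus. y \<noteq> 2 * pi"
    using AE_completion [OF AE_lborel_singleton, of "2 * pi"]
    by (subst AE_restrict_space_iff) (auto elim: eventually_mono)
  moreover have "AE y in torus. y \<in> {0..2 * pi}"
    by (rule AE_I2) simp
  ultimately have "AE y in torus. sawtooth y * char (- k) y = of_real y * char (- k) y"
  proof eventually_elim
    case (elim y)
    then have "frac (y / (2 * pi)) = y / (2 * pi)"
      by (subst frac_eq) auto
    then show ?case
      by (simp add: sawtooth_def)
  qed
  then have "(LINT y|torus. sawtooth y * char (- k) y) = (LINT y|torus. of_real y * char (- k) y)"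
    by (intro integral_cong_AE borel_measurable_torus borel_measurable_times borel_measurable_sawtooth
        borel_measurable_continuous_onI continuous_intros)
  \<comment> \<open>The antiderivative comes from integration by parts. By periodicity its second
    summand cancels between the endpoints.\<close>
  also have "\<dots> = (of_real (2 * pi) * char (- k) (2 * pi) * \<i> / of_int k + char (- k) (2 * pi) / of_int k ^ 2)
      - (of_real 0 * char (- k) 0 * \<i> / of_int k + char (- k) 0 / of_int k ^ 2)"
  proof (rule torus_integral_FTC)
    show "((\<lambda>x. of_real x * char (- k) x * \<i> / of_int k + char (- k) x / of_int k ^ 2)
        has_vector_derivative of_real x * char (- k) x) (at x)" for x
      using assms
      by (auto intro!: derivative_eq_intros has_vector_derivative_char
          simp: field_simps power2_eq_square)
  qed (intro continuous_intros)
  also have "\<dots> = 2 * pi * \<i> / of_int k"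
    by (simp only: char_period) (simp add: char_def)
  finally show ?thesis
    by (simp add: fourier_coeff_char)
qed

text \<open>The derivative is tested against the Fejer kernel of order \<open>L\<close> modulated to the
  frequencies \<open>L + 1, \<dots>, 3 L - 1\<close>: there the cutoff equals \<open>1\<close> and all contributions have
  the same phase.\<close>

lemma Lp_norm_infinity_sawtooth_ge:
  assumes "vp_cutoff \<eta>" "\<alpha> \<ge> 1" "L \<ge> 1" "8 * L \<le> N"
  shows "ennreal (real L ^ \<alpha>) \<le> Lp_norm \<infinity> (nth_deriv \<alpha> (vp_mean \<eta> N sawtooth))"
proof -
  let ?g = "nth_deriv \<alpha> (vp_mean \<eta> N sawtooth)"
  let ?m = "\<lambda>r s. 2 * int L - int r + int s"
  have N: "N \<ge> 1"
    using assms by simp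
  note cont = continuous_on_nth_deriv_vp_mean [OF assms(1) N]
  \<comment> \<open>The denominator of the coefficient \<open>\<i> / m\<close> cancels one of the
    \<open>\<alpha>\<close> factors \<open>m\<close>. What remains is the positive number
    \<open>m ^ a\<close> times the phase \<open>\<i> ^ Suc \<alpha>\<close>, the same for all
    \<open>m\<close>.\<close>
  obtain a where a: "\<alpha> = Suc a"
    using assms(2) by (cases \<alpha>) auto
  have coeff: "(LINT x|torus. ?g x * char (- (2 * int L)) x * char (int r - int s) x)
      = 2 * pi * \<i> ^ Suc \<alpha> * of_real (of_int (?m r s) ^ a)" if "r < L" "s < L" for r s
  proof -
    have eq: "char (- (2 * int L)) x * char (int r - int s) x = char (- ?m r s) x" for x
      by (simp add: char_add [symmetric] algebra_simps)
    \<comment> \<open>Since \<open>r\<close> and \<open>s\<close> are below \<open>L\<close>, the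
      frequency is positive and less than \<open>3 * L\<close>, so its double is below
      \<open>6 * L\<close>.\<close>
    have "?m r s \<noteq> 0" "2 * \<bar>?m r s\<bar> \<le> int N"
      using that assms by auto
    then have "(LINT x|torus. ?g x * char (- (2 * int L)) x * char (int r - int s) x)
        = 2 * pi * (\<i> * of_int (?m r s)) ^ \<alpha> * (\<i> / of_int (?m r s))"
      unfolding mult.assoc eq
      by (simp only: integral_nth_deriv_vp_mean [OF assms(1) N] mult.assoc
          fourier_coeff_sawtooth [OF \<open>?m r s \<noteq> 0\<close>])
    moreover have "(\<i> * z) ^ \<alpha> * (\<i> / z) = \<i> ^ Suc \<alpha> * z ^ a" if "z \<noteq> 0" for z :: complex
      using that by (simp add: a power_mult_distrib mult_ac)
    ultimately show ?thesis
      using \<open>?m r s \<noteq> 0\<close>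
      by (simp only: mult.assoc of_int_eq_0_iff not_False_eq_True of_real_power of_real_of_int_eq)
  qed
  \<comment> \<open>All \<open>L * L\<close> frequencies are at least \<open>L\<close>.\<close>
  have "(\<Sum>r<L. \<Sum>s<L. real L ^ a) \<le> (\<Sum>r<L. \<Sum>s<L. real_of_int (?m r s) ^ a)"
    by (intro sum_mono power_mono) auto
  then have *: "real L * real L ^ \<alpha> \<le> (\<Sum>r<L. \<Sum>s<L. real_of_int (?m r s) ^ a)"
    by (simp add: a mult_ac)
  have "(LINT x|torus. ?g x * char (- (2 * int L)) x * fejer L x)
      = (\<Sum>r<L. \<Sum>s<L. 2 * pi * \<i> ^ Suc \<alpha> * of_real (of_int (?m r s) ^ a)) / L"
    using coeff by (subst integral_mult_fejer) (auto intro!: continuous_intros cont)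
  also have "\<dots> = \<i> ^ Suc \<alpha> * of_real (2 * pi * (\<Sum>r<L. \<Sum>s<L. real_of_int (?m r s) ^ a) / L)"
    by (simp add: sum_distrib_left mult_ac)
  finally have "norm (LINT x|torus. ?g x * char (- (2 * int L)) x * fejer L x)
      = 2 * pi * \<bar>\<Sum>r<L. \<Sum>s<L. real_of_int (?m r s) ^ a\<bar> / L"
    by (simp only: norm_mult norm_power norm_of_real) (simp add: abs_mult)
  also have "\<dots> \<ge> 2 * pi * real L ^ \<alpha>"
    using * assms(3) by (simp add: field_simps)
  finally have "ennreal (2 * pi * real L ^ \<alpha>) \<le> Lp_norm \<infinity> ?g * ennreal (2 * pi)"
    using norm_integral_fejer_le_Lp_norm_infinity [OF cont assms(3), where k = "- (2 * int L)"]
    by (meson ennreal_leI order_trans)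
  then have "ennreal (real L ^ \<alpha>) * ennreal (2 * pi) \<le> Lp_norm \<infinity> ?g * ennreal (2 * pi)"
    by (simp add: ennreal_mult [symmetric] mult_ac)
  then show ?thesis
    using ennreal_mult_le_mult_iff [of "ennreal (2 * pi)" "ennreal (real L ^ \<alpha>)" "Lp_norm \<infinity> ?g"]
    by (simp add: mult.commute ennreal_eq_0_iff linorder_not_le)
qed

subsection \<open>The case of the integral norm: series of Fejer kernels\<close>

text \<open>Summing in \<open>ennreal\<close> gives a value at every point and makes measurability
  immediate. \<open>enn2real\<close> sends points of divergence to 0; when all \<open>N j\<close>
  are positive they form a null set, because the integral of the sum is finite.\<close>

definition fejer_series :: "(nat \<Rightarrow> nat) \<Rightarrow> real \<Rightarrow> complex" where
  "fejer_series N x = of_real (enn2real (\<Sum>j. ennreal ((1/2) ^ j * fejer (N j) x)))"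

lemma borel_measurable_fejer [measurable]: "fejer N \<in> borel_measurable borel"
  by (intro borel_measurable_continuous_onI continuous_intros)

lemma borel_measurable_fejer_series [measurable]: "fejer_series N \<in> borel_measurable borel"
  unfolding fejer_series_def by measurable

lemma suminf_geometric_2pi: "(\<Sum>j. ennreal ((1/2) ^ j * (2 * pi))) = ennreal (4 * pi)"
proof -
  have "(\<lambda>j. (1/2) ^ j * (2 * pi)) sums (1 / (1 - 1/2) * (2 * pi))"
    by (intro sums_mult2 geometric_sums) simp
  then show ?thesis
    by (subst suminf_ennreal_eq [where x = "4 * pi"]) auto
qed

text \<open>By monotone convergence the integral passes inside the sum; every kernel has mass
  \<open>2 * pi\<close>, which leaves a geometric series.\<close>

lemma nn_integral_fejer_sum_shift:
  assumes "\<And>j. N j \<ge> 1"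
  shows "(\<integral>\<^sup>+ x. (\<Sum>j. ennreal ((1/2) ^ j * fejer (N j) (x + t))) \<partial>torus) = ennreal (4 * pi)"
proof -
  have meas: "(\<lambda>x. ennreal (fejer n (x + t))) \<in> borel_measurable torus"
    "(\<lambda>x. ennreal c * ennreal (fejer n (x + t))) \<in> borel_measurable torus" for n c
    by (rule borel_measurable_torus, measurable)+
  have "(\<integral>\<^sup>+ x. (\<Sum>j. ennreal ((1/2) ^ j * fejer (N j) (x + t))) \<partial>torus)
      = (\<Sum>j. ennreal ((1/2) ^ j) * (\<integral>\<^sup>+ x. ennreal (fejer (N j) (x + t)) \<partial>torus))"
    by (simp add: ennreal_mult fejer_nonneg nn_integral_suminf nn_integral_cmult meas)
  also have "\<dots> = (\<Sum>j. ennreal ((1/2) ^ j * (2 * pi)))"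
    by (simp only: nn_integral_fejer_shift [OF assms]) (simp add: ennreal_mult)
  finally show ?thesis
    by (simp only: suminf_geometric_2pi)
qed

lemma nn_integral_fejer_series_shift_le:
  assumes "\<And>j. N j \<ge> 1"
  shows "(\<integral>\<^sup>+ x. ennreal (norm (fejer_series N (x + t))) \<partial>torus) \<le> ennreal (4 * pi)"
proof -
  have "ennreal (enn2real y) \<le> y" for y
    by (cases y) auto
  then have "(\<integral>\<^sup>+ x. ennreal (norm (fejer_series N (x + t))) \<partial>torus)
      \<le> (\<integral>\<^sup>+ x. (\<Sum>j. ennreal ((1/2) ^ j * fejer (N j) (x + t))) \<partial>torus)"
    by (intro nn_integral_mono) (simp add: fejer_series_def)
  then show ?thesis
    by (simp only: nn_integral_fejer_sum_shift [OF assms])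
qed

lemma fejer_series_in_Lp:
  assumes "\<And>j. N j \<ge> 1"
  shows "fejer_series N \<in> Lp_torus 1"
proof -
  have "Lp_norm 1 (fejer_series N) \<le> ennreal (4 * pi)"
    using nn_integral_fejer_series_shift_le [of N 0, OF assms] by (simp add: Lp_norm_1)
  then have "Lp_norm 1 (fejer_series N) < \<infinity>"
    by (simp add: order_le_less_trans)
  moreover have "fejer_series N (x + 2 * pi) = fejer_series N x" for x
    by (simp add: fejer_series_def fejer_periodic)
  ultimately show ?thesis
    by (simp add: Lp_torus_def measurable_completion)
qed

text \<open>The integral is \<open>2 * pi / N\<close> times the number of pairs with
  \<open>r - s = k\<close>. For \<open>0 \<le> k \<le> N / 2\<close> there are
  \<open>N - k \<ge> N / 2\<close> of them.\<close>

lemma integral_fejer_char: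
  obtains t where "t \<ge> 0" "(LINT x|torus. fejer N x * char (- k) x) = complex_of_real t"
    "\<lbrakk>N \<ge> 1; 0 \<le> k; 2 * k \<le> int N\<rbrakk> \<Longrightarrow> t \<ge> pi"
proof -
  define t where "t = (\<Sum>r<N. \<Sum>s<N. if int r - int s = k then 2 * pi else 0) / N"
  have "(LINT x|torus. fejer N x * char (- k) x) = (LINT x|torus. char (- k) x * fejer N x)"
    by (simp only: mult.commute)
  also have "\<dots> = (\<Sum>r<N. \<Sum>s<N. LINT x|torus. char (int r - int s - k) x) / N"
    by (subst integral_mult_fejer) (simp_all add: char_add [symmetric] continuous_on_char)
  also have "\<dots> = complex_of_real t"
    unfolding t_def integral_char by simp
  finally have "(LINT x|torus. fejer N x * char (- k) x) = complex_of_real t" .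
  moreover have "t \<ge> 0"
    unfolding t_def by (intro divide_nonneg_nonneg sum_nonneg) auto
  moreover have "t \<ge> pi" if "N \<ge> 1" "0 \<le> k" "2 * k \<le> int N"
  proof -
    \<comment> \<open>Each \<open>s < N - k\<close> yields one admissible pair, with
      \<open>r = s + k < N\<close>.\<close>
    have "real N * pi \<le> (\<Sum>s<N - nat k. 2 * pi)"
      using that by (simp add: of_nat_diff nat_le_iff)
    also have "\<dots> = (\<Sum>s<N - nat k. \<Sum>r<N. if r = s + nat k then 2 * pi else 0)"
      by (intro sum.cong) auto
    also have "\<dots> \<le> (\<Sum>s<N. \<Sum>r<N. if r = s + nat k then 2 * pi else 0)"
      by (intro sum_mono2 sum_nonneg) auto
    also have "\<dots> = (\<Sum>r<N. \<Sum>s<N. if r = s + nat k then 2 * pi else 0)"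
      by (rule sum.swap)
    also have "\<dots> = (\<Sum>r<N. \<Sum>s<N. if int r - int s = k then 2 * pi else 0)"
      using that by (intro sum.cong refl if_cong) auto
    finally show ?thesis
      unfolding t_def using that by (simp add: field_simps)
  qed
  ultimately show ?thesis
    using that by blast
qed

text \<open>Sum and integral may be interchanged because the integral norms
  \<open>(1/2) ^ j * (2 * pi)\<close> of the terms are summable.\<close>

lemma integral_fejer_series_char_sums:
  assumes "\<And>j. N j \<ge> 1"
  shows "(\<lambda>j. (1/2) ^ j * (LINT x|torus. fejer (N j) x * char (- k) x))
    sums (LINT x|torus. fejer_series N x * char (- k) x)"
proof -
  let ?u = "\<lambda>j x. complex_of_real ((1/2) ^ j * fejer (N j) x) * char (- k) x"
  have norm_u: "norm (?u j x) = (1/2) ^ j * fejer (N j) x" for j x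
    by (simp add: norm_mult norm_power norm_divide fejer_nonneg)
  have "AE x in torus. (\<Sum>j. ennreal ((1/2) ^ j * fejer (N j) x)) \<noteq> \<infinity>"
    using nn_integral_fejer_sum_shift [of N 0, OF assms]
    by (intro nn_integral_noteq_infinite borel_measurable_torus) simp_all
  then have AE_summable: "AE x in torus. summable (\<lambda>j. (1/2) ^ j * fejer (N j) x)"
    by eventually_elim (auto intro!: summable_suminf_not_top simp: fejer_nonneg)
  have "(\<lambda>j. LINT x|torus. ?u j x) sums (LINT x|torus. (\<Sum>j. ?u j x))"
  proof (rule sums_integral)
    show "integrable torus (?u j)" for j
      by (intro integrable_torus_continuous continuous_intros)
    show "AE x in torus. summable (\<lambda>j. norm (?u j x))"
      using AE_summable by (simp only: norm_u)
    have "summable (\<lambda>j. (1/2) ^ j * (2 * pi) :: real)"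
      by (intro summable_mult2 summable_geometric) simp
    then show "summable (\<lambda>j. LINT x|torus. norm (?u j x))"
      using integral_fejer_shift [OF assms, of _ 0] by (simp only: norm_u) simp
  qed
  moreover have "(LINT x|torus. (\<Sum>j. ?u j x)) = (LINT x|torus. fejer_series N x * char (- k) x)"
  proof (rule integral_cong_AE)
    show "AE x in torus. (\<Sum>j. ?u j x) = fejer_series N x * char (- k) x"
      using AE_summable
    proof eventually_elim
      case (elim x)
      then have "fejer_series N x = complex_of_real (\<Sum>j. (1/2) ^ j * fejer (N j) x)"
        unfolding fejer_series_def
        by (subst suminf_ennreal2) (auto simp: fejer_nonneg suminf_nonneg)
      also have "\<dots> = (\<Sum>j. complex_of_real ((1/2) ^ j * fejer (N j) x))"
        using elim by (rule suminf_of_real)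
      finally show ?case
        using elim by (simp only: suminf_mult2 summable_of_real)
    qed
    have [measurable]: "char l \<in> borel_measurable borel" for l
      by (intro borel_measurable_continuous_onI continuous_on_char)
    show "(\<lambda>x. \<Sum>j. ?u j x) \<in> borel_measurable torus"
      "(\<lambda>x. fejer_series N x * char (- k) x) \<in> borel_measurable torus"
      by (rule borel_measurable_torus, measurable)+
  qed
  ultimately show ?thesis
    by (simp add: mult.assoc)
qed

text \<open>All kernels contribute nonnegative reals to the coefficient, so nothing cancels and the
  \<open>j\<close>-th term alone is a lower bound: at least \<open>(1/2) ^ j * pi\<close>, divided
  by \<open>2 * pi\<close>.\<close>

lemma norm_fourier_coeff_fejer_series_ge:
  assumes "\<And>j. N j \<ge> 1" "0 \<le> k" "2 * k \<le> int (N j)"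
  shows "norm (fourier_coeff (fejer_series N) k) \<ge> (1/2) ^ Suc j"
proof -
  have "\<exists>t\<ge>0. (LINT x|torus. fejer (N i) x * char (- k) x) = complex_of_real t
      \<and> (2 * k \<le> int (N i) \<longrightarrow> t \<ge> pi)" for i
    by (rule integral_fejer_char [of "N i" k]) (use assms(1) [of i] assms(2) in auto)
  then obtain t where t: "\<And>i. t i \<ge> 0"
    "\<And>i. (LINT x|torus. fejer (N i) x * char (- k) x) = complex_of_real (t i)" "t j \<ge> pi"
    using assms(3) by metis
  have "(\<lambda>i. complex_of_real ((1/2) ^ i * t i)) sums (LINT x|torus. fejer_series N x * char (- k) x)"
    using integral_fejer_series_char_sums [OF assms(1), where k = k] by (simp add: t)
  from sums_Re [OF this]
  have "(\<lambda>i. (1/2) ^ i * t i) sums Re (LINT x|torus. fejer_series N x * char (- k) x)"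
    by simp
  then have "(\<Sum>i\<in>{j}. (1/2) ^ i * t i) \<le> Re (LINT x|torus. fejer_series N x * char (- k) x)"
    using t(1) sum_le_suminf [of "\<lambda>i. (1/2) ^ i * t i" "{j}"] by (simp add: sums_iff)
  also have "\<dots> \<le> norm (LINT x|torus. fejer_series N x * char (- k) x)"
    by (rule complex_Re_le_cmod)
  finally have "(1/2) ^ j * t j \<le> norm (LINT x|torus. fejer_series N x * char (- k) x)"
    by simp
  moreover have "(1/2) ^ j * pi \<le> (1/2) ^ j * t j"
    using t(3) by simp
  ultimately show ?thesis
    by (simp add: fourier_coeff_char norm_mult norm_divide field_simps)
qed

text \<open>Testing against one character suffices. The frequency \<open>2 ^ (k - 1)\<close> is the
  highest at which the cutoff is known to be 1; being half of \<open>2 ^ k\<close>, it costs the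
  factor \<open>(1/2) ^ \<alpha>\<close>.\<close>

lemma Lp_norm_1_vp_mean_ge:
  assumes "vp_cutoff \<eta>" "k \<ge> 1"
  shows "ennreal ((1/2) ^ \<alpha> * 2 ^ (\<alpha> * k) * norm (fourier_coeff f (2 ^ (k - 1))))
    \<le> Lp_norm 1 (nth_deriv \<alpha> (vp_mean \<eta> (2 ^ k) f))"
proof -
  let ?g = "nth_deriv \<alpha> (vp_mean \<eta> (2 ^ k) f)"
  obtain l where l: "k = Suc l"
    using assms(2) by (cases k) auto
  have "(LINT x|torus. ?g x * char (- (2 ^ l)) x) = 2 * pi * (\<i> * of_int (2 ^ l)) ^ \<alpha> * fourier_coeff f (2 ^ l)"
    by (rule integral_nth_deriv_vp_mean [OF assms(1)]) (auto simp: l)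
  then have "norm (LINT x|torus. ?g x * char (- (2 ^ l)) x)
      = 2 * pi * (2 ^ (\<alpha> * l) * norm (fourier_coeff f (2 ^ l)))"
    by (simp add: norm_mult norm_power power_mult mult.commute [of \<alpha>])
  also have "\<dots> \<ge> 1 * (2 ^ (\<alpha> * l) * norm (fourier_coeff f (2 ^ l)))"
    using pi_ge_two by (intro mult_right_mono) auto
  also have "1 * (2 ^ (\<alpha> * l) * norm (fourier_coeff f (2 ^ l)))
      = (1/2) ^ \<alpha> * 2 ^ (\<alpha> * k) * norm (fourier_coeff f (2 ^ (k - 1)))"
    by (simp add: l power_add power_divide)
  finally have "ennreal ((1/2) ^ \<alpha> * 2 ^ (\<alpha> * k) * norm (fourier_coeff f (2 ^ (k - 1))))
      \<le> ennreal (norm (LINT x|torus. ?g x * char (- (2 ^ l)) x))"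
    by (rule ennreal_leI)
  also have "\<dots> \<le> Lp_norm 1 ?g"
    by (intro norm_integral_le_Lp_norm_1 continuous_on_nth_deriv_vp_mean assms) simp
  finally show ?thesis .
qed

section \<open>The counterexamples for \<open>p = \<infinity>\<close> and
  \<open>p = 1\<close>\<close>

theorem theorem9p6:
  fixes \<eta> :: "real \<Rightarrow> real" and p :: ennreal and \<alpha> :: nat and q :: real
  assumes "vp_cutoff \<eta>"
    and "p = 1 \<or> p = \<infinity>"
    and "\<alpha> \<ge> 1"
    and "q > 0"
  shows "\<exists>f\<in>Lp_torus p.
           \<not> (\<exists>C::real. C \<ge> 0 \<and>
                (\<forall>n::nat. n \<ge> 1 \<longrightarrow>
                   (\<Sum>\<^sub>\<infinity>k\<in>{n+1..}. ennreal (2 powr (- q * real \<alpha> * real k))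
                        * Lp_norm p (nth_deriv \<alpha> (vp_mean \<eta> (2 ^ k) f)) epowr q) epowr (1 / q)
                   \<le> ennreal C * modulus \<alpha> p f (2 powr (- real n))))"
  using assms(2)
proof
  assume p: "p = \<infinity>"
  show ?thesis
    unfolding p
  proof (intro bexI [OF _ sawtooth_in_Lp]
      \<comment> \<open>The lower bound for the sawtooth is applied with
        \<open>L = 2 ^ (k - 3)\<close>, the largest value with \<open>8 * L \<le> 2 ^ k\<close>;
        this is the source of \<open>1/8\<close>.\<close>
      no_constant_if_divergent [where b = "\<lambda>_. 1" and c = "(1/8) ^ \<alpha>"] assms)
    fix k :: nat
    assume "k \<ge> 3"
    then obtain l where l: "k = l + 3"
      by (metis add.commute le_Suc_ex)
    have "ennreal (real (2 ^ l) ^ \<alpha>) \<le> Lp_norm \<infinity> (nth_deriv \<alpha> (vp_mean \<eta> (2 ^ k) sawtooth))"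
      by (intro Lp_norm_infinity_sawtooth_ge assms) (auto simp: l power_add)
    moreover have "(1/8) ^ \<alpha> * 2 ^ (\<alpha> * k) * 1 = real (2 ^ l) ^ \<alpha>"
    proof -
      have "(2::real) ^ (\<alpha> * k) = (2 ^ l * 8) ^ \<alpha>"
        by (simp add: l power_add mult.commute [of \<alpha>] power_mult)
      then show ?thesis
        by (simp add: power_mult_distrib power_divide)
    qed
    ultimately show "ennreal ((1/8) ^ \<alpha> * 2 ^ (\<alpha> * k) * 1)
        \<le> Lp_norm \<infinity> (nth_deriv \<alpha> (vp_mean \<eta> (2 ^ k) sawtooth))"
      by simp
  next
    fix B :: real
    have "card {3::nat..<3 + nat \<lceil>B\<rceil>} = nat \<lceil>B\<rceil>"
      by simp
    then show "\<exists>F\<subseteq>{3::nat..}. finite F \<and> B \<le> (\<Sum>k\<in>F. 1 powr q)"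
      by (intro exI [of _ "{3..<3 + nat \<lceil>B\<rceil>}"]) (auto simp: real_nat_ceiling_ge)
  next
    show "modulus \<alpha> \<infinity> sawtooth \<delta> < \<infinity>" for \<delta>
      by (rule modulus_infinity_finite [OF borel_measurable_sawtooth norm_sawtooth_le])
  qed auto
next
  assume p: "p = 1"
  \<comment> \<open>The \<open>m j - 2\<close> indices in \<open>{3..m j}\<close> each contribute at
    least \<open>2 powr (- (j + 1) * q)\<close> to the sum of \<open>q\<close>-th powers; this
    choice makes their total at least \<open>j\<close>.\<close>
  define m where "m j = nat \<lceil>real j * 2 powr (real (Suc j) * q)\<rceil> + 2" for j
  define f where "f = fejer_series (\<lambda>j. 2 ^ m j)"
  have f: "f \<in> Lp_torus 1"
    unfolding f_def by (rule fejer_series_in_Lp) simp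
  show ?thesis
    unfolding p
  proof (intro bexI [OF _ f] no_constant_if_divergent
      [where b = "\<lambda>k. norm (fourier_coeff f (2 ^ (k - 1)))" and c = "(1/2) ^ \<alpha>"] assms)
    fix B :: real
    define j where "j = nat \<lceil>B\<rceil>"
    have le: "(1/2) ^ Suc j \<le> norm (fourier_coeff f (2 ^ (k - 1)))" if "k \<in> {3..m j}" for k
    proof -
      \<comment> \<open>For \<open>k \<le> m j\<close> the frequency \<open>2 ^ (k - 1)\<close> is
        thus at most half the order \<open>2 ^ m j\<close> of the \<open>j\<close>-th
        kernel.\<close>
      have "(2::int) * 2 ^ (k - 1) = 2 ^ k"
        using that by (cases k) auto
      then show ?thesis
        unfolding f_def using that
        by (intro norm_fourier_coeff_fejer_series_ge) auto
    qed
    have half: "((1/2) ^ Suc j) powr q = 1 / 2 powr (real (Suc j) * q)"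
      by (simp add: powr_realpow [symmetric] powr_powr powr_divide power_divide del: power_Suc of_nat_Suc)
    have "B \<le> real j"
      by (simp add: j_def real_nat_ceiling_ge)
    also have "\<dots> = real j * 2 powr (real (Suc j) * q) * ((1/2) ^ Suc j) powr q"
      by (simp add: half del: power_Suc of_nat_Suc)
    also have "\<dots> \<le> real (m j - 2) * ((1/2) ^ Suc j) powr q"
      unfolding m_def by (intro mult_right_mono) (auto simp: real_nat_ceiling_ge)
    also have "\<dots> = (\<Sum>k\<in>{3..m j}. ((1/2) ^ Suc j) powr q)"
      by (simp add: m_def)
    also have "\<dots> \<le> (\<Sum>k\<in>{3..m j}. norm (fourier_coeff f (2 ^ (k - 1))) powr q)"
      using assms(4) by (intro sum_mono powr_mono2 le) auto
    finally show "\<exists>F\<subseteq>{3..}. finite F \<and> B \<le> (\<Sum>k\<in>F. norm (fourier_coeff f (2 ^ (k - 1))) powr q)"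
      by (intro exI [of _ "{3..m j}"]) auto
  next
    show "modulus \<alpha> 1 f \<delta> < \<infinity>" for \<delta>
      unfolding f_def
      by (rule modulus_1_finite [OF borel_measurable_fejer_series nn_integral_fejer_series_shift_le]) simp
  next
    show "ennreal ((1/2) ^ \<alpha> * 2 ^ (\<alpha> * k) * norm (fourier_coeff f (2 ^ (k - 1))))
        \<le> Lp_norm 1 (nth_deriv \<alpha> (vp_mean \<eta> (2 ^ k) f))" if "k \<ge> 3" for k
      using that by (intro Lp_norm_1_vp_mean_ge assms) simp
  qed auto
qed

end
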